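(* For any $T_2$ (Hausdorff) topological space $X$ and any positive integer $n$, the games $G_1(\mathcal{O},\mathcal{O})$ and $G_n(\mathcal{O},\mathcal{O})$ on $X$ are equivalent.
   Context: Let $\mathcal{O}$ denote the collection of all open covers of $X$. All games are two-player games of length $\omega$ with perfect information, with rounds $m=0,1,2,\dots$. For a positive integer $k$, the $k$-Rothberger game $G_k(\mathcal{O},\mathcal{O})$ on $X$: in round $m$, player I plays an open cover $\mathcal{U}_m\in\mathcal{O}$, and player II responds by choosing $k$ sets $U_m^0,\dots,U_m^{k-1}$ from $\mathcal{U}_m$ (repetitions allowed). Player II wins the run iff $X=\bigcup_m\bigcup_{i<k}U_m^i$; otherwise player I wins. The game $G_1(\mathcal{O},\mathcal{O})$ (the case $k=1$) is the Rothberger game. Two games are equivalent if whenever one of the players has a winning strategy in one of the games, then that same player has a winning strategy in the other game. *)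

theory Defs
  imports "HOL-Analysis.Analysis"
begin

definition open_covers :: "'a topology \<Rightarrow> 'a set set set" where
  "open_covers X = {\<U>. (\<forall>U\<in>\<U>. openin X U) \<and> \<Union>\<U> = topspace X}"

text \<open>
  Games of length \<open>\<omega>\<close> with perfect information: in each round player I makes a move \<open>p\<close> from
  \<open>moves_I\<close>, and player II answers with an element of \<open>moves_II p\<close>. A player who has no legal move
  loses, so \<open>wins_II\<close> is consulted only for complete runs; player I wins the runs that II does not
  win.
\<close>

record ('p, 'q) game =
  moves_I :: "'p set"
  moves_II :: "'p \<Rightarrow> 'q set"
  wins_II :: "(nat \<Rightarrow> 'p) \<Rightarrow> (nat \<Rightarrow> 'q) \<Rightarrow> bool"

text \<open>
  A strategy of player I takes the list of II's previous answers, a strategy of player II the list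
  of all moves of I so far, including the one to be answered. Lists are in chronological order.
\<close>

definition strategy_I :: "('p, 'q) game \<Rightarrow> ('q list \<Rightarrow> 'p) \<Rightarrow> bool" where
  "strategy_I G \<sigma> \<longleftrightarrow> (\<forall>qs. \<sigma> qs \<in> moves_I G)"

definition strategy_II :: "('p, 'q) game \<Rightarrow> ('p list \<Rightarrow> 'q) \<Rightarrow> bool" where
  "strategy_II G \<tau> \<longleftrightarrow> (\<forall>ps. ps \<noteq> [] \<and> set ps \<subseteq> moves_I G \<longrightarrow> \<tau> ps \<in> moves_II G (last ps))"

definition winning_strategy_I :: "('p, 'q) game \<Rightarrow> ('q list \<Rightarrow> 'p) \<Rightarrow> bool" where
  "winning_strategy_I G \<sigma> \<longleftrightarrow> strategy_I G \<sigma> \<and>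
     (\<forall>p q. (\<forall>m. p m = \<sigma> (map q [0..<m]) \<and> q m \<in> moves_II G (p m)) \<longrightarrow> \<not> wins_II G p q)"

definition winning_strategy_II :: "('p, 'q) game \<Rightarrow> ('p list \<Rightarrow> 'q) \<Rightarrow> bool" where
  "winning_strategy_II G \<tau> \<longleftrightarrow> strategy_II G \<tau> \<and>
     (\<forall>p q. (\<forall>m. p m \<in> moves_I G \<and> q m = \<tau> (map p [0..<Suc m])) \<longrightarrow> wins_II G p q)"

definition equivalent_games :: "('p, 'q) game \<Rightarrow> ('r, 's) game \<Rightarrow> bool" where
  "equivalent_games G H \<longleftrightarrow>
     ((\<exists>\<sigma>. winning_strategy_I G \<sigma>) \<longleftrightarrow> (\<exists>\<sigma>. winning_strategy_I H \<sigma>)) \<and>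
     ((\<exists>\<tau>. winning_strategy_II G \<tau>) \<longleftrightarrow> (\<exists>\<tau>. winning_strategy_II H \<tau>))"

text \<open>
  The answers in the \<open>k\<close>-Rothberger game are \<open>k\<close>-tuples of members of the current cover,
  represented as lists of length \<open>k\<close>; in particular, repetitions are allowed.
\<close>

definition Rothberger_game :: "nat \<Rightarrow> 'a topology \<Rightarrow> ('a set set, 'a set list) game" where
  "Rothberger_game k X =
     \<lparr> moves_I = open_covers X,
       moves_II = (\<lambda>\<U>. {Us. length Us = k \<and> set Us \<subseteq> \<U>}),
       wins_II = (\<lambda>\<U> Us. topspace X = (\<Union>m. \<Union>i<k. Us m ! i)) \<rparr>"

end

theory Submission
  imports Defs
begin

text \<open>
  A winning strategy of II survives when II gets more answers per round, one of I when II gets fewer.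
  The two other implications carry the weight.

  Player I: without a winning strategy for I in \<open>G\<^sub>n\<close>, the space satisfies the selection principle
  \<open>S\<^sub>1(\<O>, \<O>)\<close>, because I may play common refinements of consecutive blocks of \<open>n\<close> covers. By
  Pawlikowski's theorem \<open>S\<^sub>1(\<O>, \<O>)\<close> excludes a winning strategy for I in \<open>G\<^sub>1\<close>.

  Player II: fix a strategy in \<open>G\<^sub>n\<close> and a position of it. As the space is Lindelof, one can name points
  \<open>x\<^sub>1, \<dots>, x\<^sub>n\<close> successively, each depending on the neighbourhoods chosen for the earlier ones, so
  that the union of the neighbourhoods contains all of the strategy's answers to some cover. In \<open>G\<^sub>1\<close>,
  II therefore answers with neighbourhoods of these points, and \<open>n\<close> rounds swallow one round of \<open>G\<^sub>n\<close>.
\<close>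

section \<open>Open covers, common refinements and the selection principle\<close>

definition cover_meet :: "'a topology \<Rightarrow> nat set \<Rightarrow> (nat \<Rightarrow> 'a set set) \<Rightarrow> 'a set set" where
  "cover_meet X I \<U> = {topspace X \<inter> (\<Inter>i\<in>I. f i) | f. \<forall>i\<in>I. f i \<in> \<U> i}"

text \<open>The selection principle S_1(O, O), with the selected sets given as a sequence.\<close>

definition Rothberger_space :: "'a topology \<Rightarrow> bool" where
  "Rothberger_space X \<longleftrightarrow>
     (\<forall>\<U> :: nat \<Rightarrow> 'a set set. (\<forall>m. \<U> m \<in> open_covers X) \<longrightarrow>
        (\<exists>V. (\<forall>m. V m \<in> \<U> m) \<and> (\<Union>m. V m) = topspace X))"

lemma open_coversI:
  assumes "\<And>U. U \<in> \<U> \<Longrightarrow> openin X U"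
    and "\<And>x. x \<in> topspace X \<Longrightarrow> \<exists>U\<in>\<U>. x \<in> U"
  shows "\<U> \<in> open_covers X"
proof -
  have "\<Union>\<U> \<subseteq> topspace X" using assms(1) openin_subset by (metis Union_least)
  then show ?thesis using assms unfolding open_covers_def by auto
qed

lemma open_covers_openin: "\<lbrakk>\<U> \<in> open_covers X; U \<in> \<U>\<rbrakk> \<Longrightarrow> openin X U"
  unfolding open_covers_def by simp

lemma open_covers_ex: "\<lbrakk>\<U> \<in> open_covers X; x \<in> topspace X\<rbrakk> \<Longrightarrow> \<exists>U\<in>\<U>. x \<in> U"
  unfolding open_covers_def by auto

lemma Rothberger_spaceD:
  fixes \<U> :: "nat \<Rightarrow> 'a set set"
  assumes "Rothberger_space X" and "\<And>m. \<U> m \<in> open_covers X"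
  shows "\<exists>V. (\<forall>m. V m \<in> \<U> m) \<and> (\<Union>m. V m) = topspace X"
  using assms unfolding Rothberger_space_def by simp

lemma openin_finite_Inter:
  assumes "finite I" and "\<And>i. i \<in> I \<Longrightarrow> openin X (f i)"
  shows "openin X (topspace X \<inter> (\<Inter>i\<in>I. f i))"
proof -
  have "openin X (\<Inter> (insert (topspace X) (f ` I)))"
    by (rule openin_Inter) (use assms in auto)
  then show ?thesis by simp
qed

lemma cover_meet_open_cover:
  assumes "finite I" and "\<And>i. i \<in> I \<Longrightarrow> \<U> i \<in> open_covers X"
  shows "cover_meet X I \<U> \<in> open_covers X"
proof (rule open_coversI)
  fix U assume "U \<in> cover_meet X I \<U>"
  then obtain f where f: "U = topspace X \<inter> (\<Inter>i\<in>I. f i)" "\<forall>i\<in>I. f i \<in> \<U> i"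
    unfolding cover_meet_def by blast
  show "openin X U"
    unfolding f(1) by (rule openin_finite_Inter[OF assms(1)]) (use f assms open_covers_openin in blast)
next
  fix x assume x: "x \<in> topspace X"
  then have "\<forall>i\<in>I. \<exists>U. U \<in> \<U> i \<and> x \<in> U"
    using assms(2) open_covers_ex by metis
  then obtain f where "\<forall>i\<in>I. f i \<in> \<U> i \<and> x \<in> f i" by metis
  then show "\<exists>U\<in>cover_meet X I \<U>. x \<in> U"
    using x unfolding cover_meet_def
    by (intro bexI[of _ "topspace X \<inter> (\<Inter>i\<in>I. f i)"] CollectI exI[of _ f]) simp_all
qed

lemma cover_meet_refines:
  assumes "V \<in> cover_meet X I \<U>" and "i \<in> I"
  shows "\<exists>U\<in>\<U> i. V \<subseteq> U"
proof -
  obtain f where "V = topspace X \<inter> (\<Inter>i\<in>I. f i)" "\<forall>i\<in>I. f i \<in> \<U> i"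
    using assms(1) unfolding cover_meet_def by blast
  then show ?thesis using assms(2) by (intro bexI[of _ "f i"]) auto
qed

section \<open>Pawlikowski's theorem for trees of open sets\<close>

text \<open>Recursion on the list of all earlier values: \<open>L n\<close> is that list, built by
  primitive recursion.\<close>

lemma ex_course_of_values:
  fixes h :: "'b list \<Rightarrow> 'b"
  shows "\<exists>b. \<forall>n. b n = h (map b [0..<n])"
proof -
  define L where "L = rec_nat [] (\<lambda>_ l. l @ [h l])"
  have "map (\<lambda>n. h (L n)) [0..<n] = L n" for n
    by (induction n) (simp_all add: L_def)
  then show ?thesis by (intro exI[of _ "\<lambda>n. h (L n)"]) simp
qed

text \<open>No single \<open>F n\<close> has to cover the space. Intersections over
  \<open>m + 1\<close> indices do form covers, because every point has infinitely many indices to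
  offer. A selected intersection lies in each of its factors, so it can be charged to any one of its
  indices.\<close>

lemma Rothberger_space_select:
  assumes R: "Rothberger_space X"
    and ne: "\<And>n. F n \<noteq> {}"
    and op: "\<And>n U. U \<in> F n \<Longrightarrow> openin X U"
    and inf: "\<And>x. x \<in> topspace X \<Longrightarrow> infinite {n::nat. x \<in> \<Union>(F n)}"
  shows "\<exists>A. (\<forall>n. A n \<in> F n) \<and> topspace X \<subseteq> (\<Union>n. A n)"
proof -
  \<comment> \<open>A set chosen from the \<open>m\<close>-th cover has \<open>m + 1\<close> indices to spend, so a fresh one is always left.\<close>
  define \<V> where "\<V> m = {topspace X \<inter> (\<Inter>n\<in>I. f n) | I f.
      finite I \<and> card I = Suc m \<and> (\<forall>n\<in>I. f n \<in> F n)}" for m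
  have "\<V> m \<in> open_covers X" for m
  proof (rule open_coversI)
    fix U assume "U \<in> \<V> m"
    then obtain I f where "U = topspace X \<inter> (\<Inter>n\<in>I. f n)" "finite I" "\<forall>n\<in>I. f n \<in> F n"
      unfolding \<V>_def by auto
    then show "openin X U" using op openin_finite_Inter[of I X f] by auto
  next
    fix x assume x: "x \<in> topspace X"
    obtain I where I: "finite I" "card I = Suc m" "I \<subseteq> {n. x \<in> \<Union>(F n)}"
      using infinite_arbitrarily_large[OF inf[OF x]] by blast
    then have "\<forall>n\<in>I. \<exists>U. U \<in> F n \<and> x \<in> U" by blast
    then obtain f where "\<forall>n\<in>I. f n \<in> F n \<and> x \<in> f n" by metis
    then show "\<exists>U\<in>\<V> m. x \<in> U"
      using I x unfolding \<V>_def
      by (intro bexI[of _ "topspace X \<inter> (\<Inter>n\<in>I. f n)"] CollectI exI[of _ I] exI[of _ f]) simp_all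
  qed
  then have "\<exists>V. (\<forall>m. V m \<in> \<V> m) \<and> (\<Union>m. V m) = topspace X"
    by (rule Rothberger_spaceD[OF R])
  then obtain V where V: "\<And>m. V m \<in> \<V> m" "(\<Union>m. V m) = topspace X"
    by blast
  have "\<exists>I f. V m = topspace X \<inter> (\<Inter>n\<in>I. f n) \<and> finite I \<and> card I = Suc m \<and> (\<forall>n\<in>I. f n \<in> F n)" for m
    using V(1)[of m] unfolding \<V>_def by blast
  then obtain I f where If: "\<And>m. V m = topspace X \<inter> (\<Inter>n\<in>I m. f m n)"
    "\<And>m. finite (I m)" "\<And>m. card (I m) = Suc m" "\<And>m n. n \<in> I m \<Longrightarrow> f m n \<in> F n"
    by metis
  obtain k where k: "\<And>m. k m = (SOME i. i \<in> I m - set (map k [0..<m]))"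
    using ex_course_of_values[of "\<lambda>l. SOME i. i \<in> I (length l) - set l"] by auto
  have kin: "k m \<in> I m - k ` {..<m}" for m
  proof -
    have "card (k ` {..<m}) < card (I m)"
      using card_image_le[of "{..<m}" k] If(3)[of m] by simp
    then have "I m - k ` {..<m} \<noteq> {}"
      by (metis card_mono Diff_eq_empty_iff finite_imageI finite_lessThan leD)
    then have "(SOME i. i \<in> I m - k ` {..<m}) \<in> I m - k ` {..<m}"
      by (rule iffD2[OF some_in_eq])
    then show ?thesis by (subst k) (simp add: atLeast0LessThan)
  qed
  have inj: "inj k"
  proof (rule linorder_injI)
    fix i j :: nat assume "i < j"
    then have "k i \<in> k ` {..<j}" by simp
    then show "k i \<noteq> k j" using kin[of j] by auto
  qed
  \<comment> \<open>Indices that no \<open>k m\<close> uses receive an arbitrary member of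
    \<open>F n\<close>.\<close>
  define A where "A n = (if n \<in> range k then f (inv k n) n else SOME U. U \<in> F n)" for n
  have "A n \<in> F n" for n
    using If(4) kin ne[of n] inj by (auto simp: A_def some_in_eq)
  moreover have "V m \<subseteq> A (k m)" for m
    using kin[of m] inj by (auto simp: A_def If(1))
  moreover have "topspace X \<subseteq> (\<Union>n. A n)"
    unfolding V(2)[symmetric] using calculation(2) by (intro UN_least) (meson UNIV_I UN_upper order_trans)
  ultimately show ?thesis by (intro exI[of _ A]) simp
qed

text \<open>
  Pawlikowski's theorem for the tree of positions against a strategy of player I. The idea is to find
  a bound \<open>b\<close> such that for every point \<open>x\<close> and infinitely many \<open>n\<close>, each node \<open>s\<close> of length \<open>n\<close> below
  \<open>b\<close> has \<open>x \<in> U s j\<close> for some \<open>j < b n\<close>. For such \<open>n\<close> the choices \<open>j\<close> are made for all nodes at once,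
  which removes the dependence on the branch and leaves a plain selection problem.
\<close>

lemma Rothberger_space_branch:
  fixes U :: "nat list \<Rightarrow> nat \<Rightarrow> 'a set"
  assumes R: "Rothberger_space X"
    and op: "\<And>s k. openin X (U s k)"
    and cov: "\<And>s. (\<Union>k. U s k) = topspace X"
  shows "\<exists>g. topspace X \<subseteq> (\<Union>n. U (map g [0..<n]) (g n))"
proof -
  \<comment> \<open>\<open>T t\<close> is the finite set of nodes lying pointwise strictly below
    \<open>t\<close>; finiteness makes \<open>good\<close> attainable and an open condition on
    \<open>x\<close>.\<close>
  define T where "T t = {s::nat list. list_all2 (<) s t}" for t
  define good where "good x t k \<longleftrightarrow> (\<forall>s\<in>T t. \<exists>j<k. x \<in> U s j)" for x t k
  have finT: "finite (T t)" for t
  proof (rule finite_subset)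
    show "T t \<subseteq> {s. set s \<subseteq> {..<Suc (sum_list t)} \<and> length s = length t}"
    proof
      fix s assume s: "s \<in> T t"
      have "s ! i < Suc (sum_list t)" if "i < length s" for i
      proof -
        have "length s = length t" "s ! i < t ! i"
          using s that by (simp_all add: T_def list_all2_conv_all_nth)
        then show ?thesis using that member_le_sum_list[of "t ! i" t] by simp
      qed
      then show "s \<in> {s. set s \<subseteq> {..<Suc (sum_list t)} \<and> length s = length t}"
        using s by (auto simp: T_def in_set_conv_nth dest: list_all2_lengthD)
    qed
  qed (rule finite_lists_length_eq, simp)
  have good_mono: "good x t k" if "good x t' k'" "list_all2 (\<le>) t t'" "k' \<le> k" for x t t' k k'
  proof -
    have "T t \<subseteq> T t'"
      using that(2) unfolding T_def list_all2_conv_all_nth by (auto intro: less_le_trans)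
    then show ?thesis using that unfolding good_def by (meson less_le_trans subsetD)
  qed
  have good_ex: "\<exists>k. good x t k" if x: "x \<in> topspace X" for x t
  proof -
    have "\<forall>s. \<exists>j. x \<in> U s j" using cov x by blast
    then obtain f where f: "\<And>s. x \<in> U s (f s)" by metis
    have "f s < Suc (\<Sum>s\<in>T t. f s)" if "s \<in> T t" for s
      using member_le_sum[OF that _ finT, of f] by simp
    then show ?thesis using f unfolding good_def by blast
  qed
  have good_open: "openin X {x \<in> topspace X. good x t k}" for t k
  proof -
    have eq: "{x \<in> topspace X. good x t k} = topspace X \<inter> (\<Inter>s\<in>T t. \<Union>j<k. U s j)"
      unfolding good_def by auto
    show ?thesis
      unfolding eq by (rule openin_finite_Inter[OF finT]) (intro openin_Union, use op in auto)
  qed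
  \<comment> \<open>If \<open>b\<close> extends \<open>t\<close> and misses \<open>x \<in> W t u\<close> from stage \<open>length t\<close> on, then it stays below \<open>u\<close>;
    choosing \<open>b\<close> above the last entries of countably many such \<open>u\<close> prevents this.\<close>
  define W where "W t u = {x \<in> topspace X. \<forall>i<length u. good x (t @ take i u) (u ! i)}" for t u
  have W_cover: "{W t u | u. length u = Suc m} \<in> open_covers X" for t m
  proof (rule open_coversI)
    fix V assume "V \<in> {W t u | u. length u = Suc m}"
    then obtain u where "V = W t u" by blast
    then have V: "V = topspace X \<inter> (\<Inter>i\<in>{..<length u}. {x \<in> topspace X. good x (t @ take i u) (u ! i)})"
      unfolding W_def by auto
    show "openin X V" unfolding V by (intro openin_finite_Inter finite_lessThan good_open)
  next
    fix x assume x: "x \<in> topspace X"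
    have "\<exists>u. length u = m \<and> x \<in> W t u" for m
    proof (induction m)
      case 0 show ?case using x by (simp add: W_def)
    next
      case (Suc m)
      then obtain u where u: "length u = m" "x \<in> W t u" by blast
      obtain k where "good x (t @ u) k" using good_ex x by blast
      then have "x \<in> W t (u @ [k])" using u by (auto simp: W_def nth_append less_Suc_eq)
      then show ?case using u by (intro exI[of _ "u @ [k]"]) simp
    qed
    then obtain u where "length u = Suc m" "x \<in> W t u" by metis
    then show "\<exists>V\<in>{W t u | u. length u = Suc m}. x \<in> V" by (intro bexI[of _ "W t u"]) auto
  qed
  have "\<exists>u. \<forall>m. length (u m) = Suc m \<and> topspace X = (\<Union>m. W t (u m))" for t
  proof -
    have "\<exists>V. (\<forall>m. V m \<in> {W t u | u. length u = Suc m}) \<and> (\<Union>m. V m) = topspace X"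
      by (rule Rothberger_spaceD[OF R W_cover])
    then obtain V where "\<forall>m. V m \<in> {W t u | u. length u = Suc m}" and V: "(\<Union>m. V m) = topspace X"
      by (elim exE conjE)
    then have "\<exists>u. length u = Suc m \<and> V m = W t u" for m by blast
    then obtain u where "\<forall>m. length (u m) = Suc m \<and> V m = W t (u m)" by metis
    then show ?thesis using V by (intro exI[of _ u]) simp
  qed
  then obtain u where u: "\<And>t m. length (u t m) = Suc m" "\<And>t. topspace X = (\<Union>m. W t (u t m))"
    by metis
  \<comment> \<open>Diagonal choice: \<open>b n\<close> exceeds, for every starting stage
    \<open>k \<le> n\<close> at once, the last entry of the list of length \<open>n - k + 1\<close>
    selected for the initial segment of \<open>b\<close> of length \<open>k\<close>.\<close>
  obtain b where b: "\<And>n. b n = Suc (\<Sum>k\<le>n. last (u (map b [0..<k]) (n - k)))"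
  proof -
    obtain b where b: "\<And>n. b n = Suc (\<Sum>k\<le>length (map b [0..<n]). last (u (take k (map b [0..<n])) (length (map b [0..<n]) - k)))"
      using ex_course_of_values[of "\<lambda>l. Suc (\<Sum>k\<le>length l. last (u (take k l) (length l - k)))"] by blast
    have "b n = Suc (\<Sum>k\<le>n. last (u (map b [0..<k]) (n - k)))" for n
      by (subst b) (simp add: take_map min_def)
    then show ?thesis using that by blast
  qed
  have last_le: "last (u (map b [0..<k]) m) \<le> b (k + m)" for k m
    using b[of "k + m"] member_le_sum[of k "{..k + m}" "\<lambda>i. last (u (map b [0..<i]) (k + m - i))"]
    by simp
  have often: "\<exists>n\<ge>k. good x (map b [0..<n]) (b n)" if x: "x \<in> topspace X" for x k
  proof (rule ccontr)
    assume bad: "\<not> ?thesis"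
    let ?t = "map b [0..<k]"
    obtain m where m: "x \<in> W ?t (u ?t m)" using u(2) x by blast
    let ?u = "u ?t m"
    have len: "length ?u = Suc m" by (rule u(1))
    \<comment> \<open>Were \<open>b (k + i) \<ge> ?u ! i\<close>, goodness would pass from
      \<open>?u\<close> down to \<open>b\<close> by \<open>good_mono\<close>, since the earlier
      entries of \<open>b\<close> are already smaller.\<close>
    have less: "b (k + i) < ?u ! i" if "i \<le> m" for i
      using that
    proof (induction i rule: less_induct)
      case (less i)
      have "list_all2 (\<le>) (map b [0..<k + i]) (?t @ take i ?u)"
        unfolding list_all2_conv_all_nth
      proof (intro conjI allI impI)
        show "length (map b [0..<k + i]) = length (?t @ take i ?u)" using less.prems len by simp
        fix j assume j: "j < length (map b [0..<k + i])"
        show "map b [0..<k + i] ! j \<le> (?t @ take i ?u) ! j"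
        proof (cases "j < k")
          case False
          then have "b (k + (j - k)) < ?u ! (j - k)" using less j by (intro less.IH) auto
          then show ?thesis using False j by (simp add: nth_append)
        qed (use j in \<open>simp add: nth_append\<close>)
      qed
      moreover have "good x (?t @ take i ?u) (?u ! i)"
        using m less.prems len unfolding W_def by simp
      moreover have "\<not> good x (map b [0..<k + i]) (b (k + i))" using bad by simp
      ultimately show ?case using good_mono leI by blast
    qed
    have "last ?u = ?u ! m" using len by (metis diff_Suc_1 last_conv_nth length_0_conv nat.distinct(1))
    then show False using less[of m] last_le[of k m] by simp
  qed
  define A where "A n \<phi> = topspace X \<inter> (\<Inter>s\<in>T (map b [0..<n]). U s (\<phi> s))" for n \<phi>
  define F where "F n = {A n \<phi> | \<phi>. \<forall>s. \<phi> s < b n}" for n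
  have bpos: "0 < b n" for n using b[of n] by simp
  have "\<exists>V. (\<forall>n. V n \<in> F n) \<and> topspace X \<subseteq> (\<Union>n. V n)"
  proof (rule Rothberger_space_select[OF R])
    show "F n \<noteq> {}" for n
    proof -
      have "A n (\<lambda>_. 0) \<in> F n" unfolding F_def by (intro CollectI exI[of _ "\<lambda>_. 0"]) (simp add: bpos)
      then show ?thesis by auto
    qed
    show "openin X V" if V: "V \<in> F n" for n V
    proof -
      obtain \<phi> where "V = A n \<phi>" using V unfolding F_def by blast
      then show ?thesis unfolding A_def using openin_finite_Inter[OF finT op] by simp
    qed
    show "infinite {n. x \<in> \<Union>(F n)}" if x: "x \<in> topspace X" for x
      unfolding infinite_nat_iff_unbounded_le
    proof
      fix k
      obtain n where n: "n \<ge> k" "good x (map b [0..<n]) (b n)" using often[OF x] by blast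
      then obtain f where f: "\<And>s. s \<in> T (map b [0..<n]) \<Longrightarrow> f s < b n \<and> x \<in> U s (f s)"
        unfolding good_def by metis
      \<comment> \<open>Outside \<open>T\<close> the value 0 respects the bound \<open>b n\<close>,
        which \<open>F n\<close> demands at all nodes.\<close>
      let ?f = "\<lambda>s. if s \<in> T (map b [0..<n]) then f s else 0"
      have "A n ?f \<in> F n" unfolding F_def using f bpos[of n] by (intro CollectI exI[of _ ?f]) auto
      moreover have "x \<in> A n ?f" using f x unfolding A_def by simp
      ultimately show "\<exists>n\<ge>k. n \<in> {n. x \<in> \<Union>(F n)}" using n(1) by blast
    qed
  qed
  then obtain V where V: "\<And>n. V n \<in> F n" "topspace X \<subseteq> (\<Union>n. V n)" by blast
  have "\<forall>n. \<exists>\<phi>. V n = A n \<phi> \<and> (\<forall>s. \<phi> s < b n)" using V(1) unfolding F_def by blast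
  then obtain \<phi> where \<phi>: "\<And>n. V n = A n (\<phi> n)" "\<And>n s. \<phi> n s < b n" by metis
  \<comment> \<open>The branch follows the simultaneous choices; as \<open>\<phi>\<close> stays
    below \<open>b\<close>, it never leaves the sets \<open>T\<close>.\<close>
  obtain g where g: "\<And>n. g n = \<phi> n (map g [0..<n])"
    using ex_course_of_values[of "\<lambda>l. \<phi> (length l) l"] by auto
  have "map g [0..<n] \<in> T (map b [0..<n])" for n
    unfolding T_def list_all2_conv_all_nth using \<phi>(2) by (simp) (metis g)
  then have "V n \<subseteq> U (map g [0..<n]) (g n)" for n
    unfolding \<phi>(1) A_def using g[of n] by auto
  then have "(\<Union>n. V n) \<subseteq> (\<Union>n. U (map g [0..<n]) (g n))" by (rule UN_mono[OF subset_refl])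
  then show ?thesis using V(2) by (intro exI[of _ g]) simp
qed

section \<open>Runs and strategies in the Rothberger games\<close>

text \<open>For legal answers only the set of chosen members matters, so padding an answer by
  repetition does not change the outcome.\<close>

lemma wins_II_Rothberger_game:
  assumes "\<And>m. Us m \<in> moves_II (Rothberger_game k X) (\<U> m)"
  shows "wins_II (Rothberger_game k X) \<U> Us \<longleftrightarrow> topspace X = (\<Union>m. \<Union>(set (Us m)))"
proof -
  have "(\<Union>i<k. Us m ! i) = \<Union>(set (Us m))" for m
    using assms[of m] by (fastforce simp: Rothberger_game_def in_set_conv_nth)
  then show ?thesis by (simp add: Rothberger_game_def)
qed

lemma winning_strategy_I_beats:
  assumes "winning_strategy_I G \<sigma>"
    and "\<And>m. p m = \<sigma> (map q [0..<m])" and "\<And>m. q m \<in> moves_II G (p m)"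
  shows "\<not> wins_II G p q"
proof -
  have "\<forall>m. p m = \<sigma> (map q [0..<m]) \<and> q m \<in> moves_II G (p m)"
    by (intro allI conjI assms)
  then show ?thesis
    by (rule assms(1)[unfolded winning_strategy_I_def, THEN conjunct2, THEN spec, THEN spec, THEN mp])
qed

lemma strategy_II_Rothberger_game:
  "strategy_II (Rothberger_game k X) \<tau> \<longleftrightarrow>
     (\<forall>ps. ps \<noteq> [] \<and> set ps \<subseteq> open_covers X \<longrightarrow> length (\<tau> ps) = k \<and> set (\<tau> ps) \<subseteq> last ps)"
  by (simp add: strategy_II_def Rothberger_game_def)

text \<open>A strategy of II fixes the answers once I's moves are given, so runs can be quantified
  over I's moves alone.\<close>

lemma winning_strategy_II_Rothberger_game:
  "winning_strategy_II (Rothberger_game k X) \<tau> \<longleftrightarrow>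
     strategy_II (Rothberger_game k X) \<tau> \<and>
     (\<forall>p. (\<forall>m. p m \<in> open_covers X) \<longrightarrow> topspace X = (\<Union>m. \<Union>(set (\<tau> (map p [0..<Suc m])))))"
    (is "_ \<longleftrightarrow> ?S \<and> ?W")
proof (cases ?S)
  case True
  have wins: "wins_II (Rothberger_game k X) p (\<lambda>m. \<tau> (map p [0..<Suc m])) \<longleftrightarrow>
      topspace X = (\<Union>m. \<Union>(set (\<tau> (map p [0..<Suc m]))))" if p: "\<And>m. p m \<in> open_covers X" for p
  proof (rule wins_II_Rothberger_game)
    fix m
    have "set (map p [0..<Suc m]) \<subseteq> open_covers X" using p by auto
    moreover have "map p [0..<Suc m] \<noteq> []" "last (map p [0..<Suc m]) = p m" by simp_all
    ultimately have "length (\<tau> (map p [0..<Suc m])) = k \<and> set (\<tau> (map p [0..<Suc m])) \<subseteq> p m"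
      using True unfolding strategy_II_Rothberger_game by metis
    then show "\<tau> (map p [0..<Suc m]) \<in> moves_II (Rothberger_game k X) (p m)"
      by (simp add: Rothberger_game_def)
  qed
  have moves: "moves_I (Rothberger_game k X) = open_covers X" by (simp add: Rothberger_game_def)
  have eq: "q = (\<lambda>m. \<tau> (map p [0..<Suc m]))" if "\<forall>m. p m \<in> open_covers X \<and> q m = \<tau> (map p [0..<Suc m])" for p q
    using that by (intro ext) blast
  show ?thesis
  proof
    assume "winning_strategy_II (Rothberger_game k X) \<tau>"
    note ws = this[unfolded winning_strategy_II_def moves, THEN conjunct2, THEN spec, THEN spec, THEN mp]
    have "wins_II (Rothberger_game k X) p (\<lambda>m. \<tau> (map p [0..<Suc m]))" if "\<forall>m. p m \<in> open_covers X" for p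
      by (rule ws) (use that in simp)
    then show "?S \<and> ?W" using True wins by metis
  next
    assume W: "?S \<and> ?W"
    show "winning_strategy_II (Rothberger_game k X) \<tau>"
      unfolding winning_strategy_II_def moves
    proof (intro conjI True allI impI)
      fix p q assume run: "\<forall>m. p m \<in> open_covers X \<and> q m = \<tau> (map p [0..<Suc m])"
      then have "topspace X = (\<Union>m. \<Union>(set (\<tau> (map p [0..<Suc m]))))" using W by blast
      then show "wins_II (Rothberger_game k X) p q"
        unfolding eq[OF run] using wins run by blast
    qed
  qed
qed (simp add: winning_strategy_II_def)

lemma winning_strategy_II_legal:
  assumes "winning_strategy_II (Rothberger_game k X) \<tau>" and "ps \<noteq> []" and "set ps \<subseteq> open_covers X"
  shows "length (\<tau> ps) = k \<and> set (\<tau> ps) \<subseteq> last ps"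
proof -
  have "strategy_II (Rothberger_game k X) \<tau>" using assms(1) by (simp add: winning_strategy_II_def)
  then show ?thesis using assms(2,3) by (simp add: strategy_II_Rothberger_game)
qed

lemma winning_strategy_II_covers:
  assumes "winning_strategy_II (Rothberger_game k X) \<tau>" and "\<And>m. p m \<in> open_covers X"
  shows "topspace X = (\<Union>m. \<Union>(set (\<tau> (map p [0..<Suc m]))))"
  using assms(1)[unfolded winning_strategy_II_Rothberger_game, THEN conjunct2, THEN spec, THEN mp] assms(2)
  by blast

section \<open>Winning strategies of player I\<close>

text \<open>Enumerating a countable subcover of each of I's covers turns positions into a tree
  indexed by lists of naturals; a covering branch of it is a run that II wins.\<close>

lemma Rothberger_space_no_winning_strategy_I:
  assumes R: "Rothberger_space X"
  shows "\<not> winning_strategy_I (Rothberger_game 1 X) \<sigma>"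
proof
  assume ws: "winning_strategy_I (Rothberger_game 1 X) \<sigma>"
  then have cover: "\<sigma> qs \<in> open_covers X" for qs
    unfolding winning_strategy_I_def strategy_I_def Rothberger_game_def by simp
  \<comment> \<open>The selection principle for a constant sequence of covers yields a countable
    subcover.\<close>
  have "\<exists>V. (\<forall>k. V k \<in> \<sigma> qs) \<and> (\<Union>k::nat. V k) = topspace X" for qs
    by (rule Rothberger_spaceD[OF R cover])
  then obtain c where c: "\<And>qs k. c qs k \<in> \<sigma> qs" "\<And>qs. (\<Union>k::nat. c qs k) = topspace X"
    by metis
  define path where "path s = foldl (\<lambda>qs k. qs @ [[c qs k]]) [] s" for s
  obtain g where g: "topspace X \<subseteq> (\<Union>n. c (path (map g [0..<n])) (g n))"
    using Rothberger_space_branch[OF R, of "\<lambda>s. c (path s)"] c cover open_covers_openin by metis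
  define q where "q n = [c (path (map g [0..<n])) (g n)]" for n
  define p where "p n = \<sigma> (map q [0..<n])" for n
  have path: "path (map g [0..<n]) = map q [0..<n]" for n
    by (induction n) (simp_all add: path_def q_def)
  have legal: "q m \<in> moves_II (Rothberger_game 1 X) (p m)" for m
    using c(1) by (simp add: Rothberger_game_def q_def p_def path)
  have "c qs k \<subseteq> topspace X" for qs k using c(2) by blast
  then have wins: "wins_II (Rothberger_game 1 X) p q"
    unfolding wins_II_Rothberger_game[of q, OF legal] using g by (auto simp: q_def)
  have "\<not> wins_II (Rothberger_game 1 X) p q"
    by (rule winning_strategy_I_beats[OF ws p_def legal])
  then show False using wins by contradiction
qed

text \<open>II's \<open>n\<close> answers in a round can be distributed over the \<open>n\<close>
  covers of the block in any order, as each answer refines all of them.\<close>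

lemma Rothberger_space_if_no_winning_strategy_I:
  assumes n: "n > 0" and no: "\<nexists>\<sigma>. winning_strategy_I (Rothberger_game n X) \<sigma>"
  shows "Rothberger_space X"
  unfolding Rothberger_space_def
proof (intro allI impI)
  fix \<U> :: "nat \<Rightarrow> 'a set set" assume \<U>: "\<forall>m. \<U> m \<in> open_covers X"
  define \<sigma> where "\<sigma> qs = cover_meet X {..<n} (\<lambda>i. \<U> (length qs * n + i))" for qs :: "'a set list list"
  have "strategy_I (Rothberger_game n X) \<sigma>"
    unfolding strategy_I_def Rothberger_game_def \<sigma>_def using \<U> by (simp add: cover_meet_open_cover)
  then have "\<exists>p q. (\<forall>m. p m = \<sigma> (map q [0..<m]) \<and> q m \<in> moves_II (Rothberger_game n X) (p m)) \<and>
      wins_II (Rothberger_game n X) p q"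
    using no unfolding winning_strategy_I_def by simp
  then obtain p q where "\<forall>m. p m = \<sigma> (map q [0..<m]) \<and> q m \<in> moves_II (Rothberger_game n X) (p m)"
      and wins: "wins_II (Rothberger_game n X) p q"
    by (elim exE conjE)
  then have pq: "\<And>m. p m = \<sigma> (map q [0..<m])"
      "\<And>m. q m \<in> moves_II (Rothberger_game n X) (p m)" by blast+
  have q: "length (q m) = n" "set (q m) \<subseteq> p m" for m
    using pq(2)[of m] by (simp_all add: Rothberger_game_def)
  \<comment> \<open>Cover number \<open>k\<close> belongs to block \<open>k div n\<close> and is
    served by answer number \<open>k mod n\<close>.\<close>
  have "\<exists>V\<in>\<U> k. q (k div n) ! (k mod n) \<subseteq> V" for k
  proof -
    have "q (k div n) ! (k mod n) \<in> cover_meet X {..<n} (\<lambda>i. \<U> (k div n * n + i))"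
      using q[of "k div n"] n nth_mem[of "k mod n" "q (k div n)"] by (auto simp: pq(1) \<sigma>_def)
    then have "\<exists>V\<in>\<U> (k div n * n + k mod n). q (k div n) ! (k mod n) \<subseteq> V"
      by (rule cover_meet_refines) (simp add: n)
    then show ?thesis by simp
  qed
  then obtain V where V: "\<And>k. V k \<in> \<U> k" "\<And>k. q (k div n) ! (k mod n) \<subseteq> V k" by metis
  have "topspace X \<subseteq> (\<Union>k. V k)"
  proof
    fix x assume "x \<in> topspace X"
    then obtain m i where "i < n" "x \<in> q m ! i"
      using wins by (auto simp: Rothberger_game_def)
    then show "x \<in> (\<Union>k. V k)" using V(2)[of "m * n + i"] by auto
  qed
  moreover have "V k \<subseteq> topspace X" for k
    using V(1) \<U> open_covers_openin openin_subset by metis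
  ultimately show "\<exists>V. (\<forall>m. V m \<in> \<U> m) \<and> (\<Union>m. V m) = topspace X" using V(1) by blast
qed

text \<open>I reads each single answer as the same set chosen \<open>n\<close> times.\<close>

lemma winning_strategy_I_single:
  assumes n: "n > 0" and ws: "winning_strategy_I (Rothberger_game n X) \<sigma>"
  shows "\<exists>\<sigma>. winning_strategy_I (Rothberger_game 1 X) \<sigma>"
proof
  let ?r = "\<lambda>q. replicate n (hd q)"
  show "winning_strategy_I (Rothberger_game 1 X) (\<lambda>qs. \<sigma> (map ?r qs))"
    unfolding winning_strategy_I_def
  proof (intro conjI allI impI)
    show "strategy_I (Rothberger_game 1 X) (\<lambda>qs. \<sigma> (map ?r qs))"
      using ws unfolding winning_strategy_I_def strategy_I_def Rothberger_game_def by simp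
    fix p q
    assume run: "\<forall>m. p m = \<sigma> (map ?r (map q [0..<m])) \<and> q m \<in> moves_II (Rothberger_game 1 X) (p m)"
    then have "q m \<in> moves_II (Rothberger_game 1 X) (p m)" for m by blast
    then have q: "length (q m) = 1" "set (q m) \<subseteq> p m" for m
      by (simp_all add: Rothberger_game_def)
    have sets: "set (?r (q m)) = set (q m)" for m
      using q(1)[of m] n by (cases "q m") auto
    have legal: "?r (q m) \<in> moves_II (Rothberger_game n X) (p m)" for m
      using q(2)[of m] sets[of m] by (simp add: Rothberger_game_def)
    have "p m = \<sigma> (map ?r (map q [0..<m]))" for m using run by blast
    then have "p m = \<sigma> (map (\<lambda>m. ?r (q m)) [0..<m])" for m by (simp add: comp_def)
    then have "\<not> wins_II (Rothberger_game n X) p (\<lambda>m. ?r (q m))"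
      by (rule winning_strategy_I_beats[OF ws _ legal])
    then have "topspace X \<noteq> (\<Union>m. \<Union>(set (q m)))"
      unfolding wins_II_Rothberger_game[of "\<lambda>m. ?r (q m)" n X p, OF legal] sets .
    moreover have "q m \<in> moves_II (Rothberger_game 1 X) (p m)" for m using run by blast
    ultimately show "\<not> wins_II (Rothberger_game 1 X) p q"
      using wins_II_Rothberger_game[of q 1 X p] by blast
  qed
qed

section \<open>Player II: more answers per round, and the Lindelof property\<close>

lemma winning_strategy_II_multi:
  assumes n: "n > 0" and ws: "winning_strategy_II (Rothberger_game 1 X) \<tau>"
  shows "\<exists>\<tau>. winning_strategy_II (Rothberger_game n X) \<tau>"
proof
  let ?t = "\<lambda>ps. replicate n (hd (\<tau> ps))"
  have \<tau>: "length (\<tau> ps) = 1 \<and> set (\<tau> ps) \<subseteq> last ps" if "ps \<noteq> []" "set ps \<subseteq> open_covers X" for ps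
    using winning_strategy_II_legal[OF ws that] .
  have sets: "set (?t ps) = set (\<tau> ps)" if "ps \<noteq> []" "set ps \<subseteq> open_covers X" for ps
    using \<tau>[OF that] n by (cases "\<tau> ps") auto
  show "winning_strategy_II (Rothberger_game n X) ?t"
    unfolding winning_strategy_II_Rothberger_game
  proof (intro conjI allI impI)
    show "strategy_II (Rothberger_game n X) ?t"
      using \<tau> sets unfolding strategy_II_Rothberger_game by simp
    fix p :: "nat \<Rightarrow> 'a set set" assume p: "\<forall>m. p m \<in> open_covers X"
    have "set (?t (map p [0..<Suc m])) = set (\<tau> (map p [0..<Suc m]))" for m
      by (rule sets) (use p in auto)
    moreover have "topspace X = (\<Union>m. \<Union>(set (\<tau> (map p [0..<Suc m]))))"
      by (rule winning_strategy_II_covers[OF ws]) (use p in blast)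
    ultimately show "topspace X = (\<Union>m. \<Union>(set (?t (map p [0..<Suc m]))))"
      by presburger
  qed
qed

text \<open>When I repeats one cover forever, II's finitely many choices per round add up to a
  countable subcover.\<close>

lemma Lindelof_space_if_winning_strategy_II:
  assumes ws: "winning_strategy_II (Rothberger_game n X) \<tau>"
  shows "Lindelof_space X"
  unfolding Lindelof_space_def
proof (intro allI impI)
  fix \<U> assume "(\<forall>U\<in>\<U>. openin X U) \<and> \<Union>\<U> = topspace X"
  then have \<U>: "\<U> \<in> open_covers X" by (simp add: open_covers_def)
  define q where "q m = \<tau> (map (\<lambda>_. \<U>) [0..<Suc m])" for m
  have "set (q m) \<subseteq> \<U>" for m
  proof -
    have "map (\<lambda>_. \<U>) [0..<Suc m] \<noteq> []" "last (map (\<lambda>_. \<U>) [0..<Suc m]) = \<U>" by simp_all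
    moreover have "set (map (\<lambda>_. \<U>) [0..<Suc m]) \<subseteq> open_covers X" using \<U> by auto
    ultimately show ?thesis
      using winning_strategy_II_legal[OF ws] unfolding q_def by metis
  qed
  moreover have "topspace X = (\<Union>m. \<Union>(set (q m)))"
    unfolding q_def by (rule winning_strategy_II_covers[OF ws \<U>])
  moreover have "countable (\<Union>m. set (q m))" by (simp add: countable_finite)
  ultimately show "\<exists>\<V>. countable \<V> \<and> \<V> \<subseteq> \<U> \<and> \<Union>\<V> = topspace X"
    by (intro exI[of _ "\<Union>m. set (q m)"]) auto
qed

section \<open>Player II: from \<open>n\<close> answers per round to one\<close>

text \<open>
  In a game of \<open>k\<close> rounds one player names points and the other open neighbourhoods of them; the
  predicate says that the former can force the union of \<open>G\<close> and these neighbourhoods to satisfy \<open>P\<close>.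
\<close>

primrec forceable :: "'a topology \<Rightarrow> ('a set \<Rightarrow> bool) \<Rightarrow> nat \<Rightarrow> 'a set \<Rightarrow> bool" where
  "forceable X P 0 G \<longleftrightarrow> P G"
| "forceable X P (Suc k) G \<longleftrightarrow>
     (\<exists>x\<in>topspace X. \<forall>V. openin X V \<and> x \<in> V \<longrightarrow> forceable X P k (G \<union> V))"

text \<open>Turns the failure to force \<open>P\<close> into one cover that defeats all choices of
  at most \<open>k\<close> members. Each point has a neighbourhood after which forcing still fails;
  the Lindelof property enumerates such neighbourhoods, and the covers given by induction are merged
  along the enumeration.\<close>

lemma not_forceable_cover:
  assumes L: "Lindelof_space X" and ne: "topspace X \<noteq> {}"
    and mono: "\<And>G H. \<lbrakk>P G; G \<subseteq> H\<rbrakk> \<Longrightarrow> P H"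
    and nf: "\<not> forceable X P k G"
  shows "\<exists>\<U>\<in>open_covers X. \<forall>\<A>\<subseteq>\<U>. finite \<A> \<and> card \<A> \<le> k \<longrightarrow> \<not> P (G \<union> \<Union>\<A>)"
  using nf
proof (induction k arbitrary: G)
  case 0
  have "{topspace X} \<in> open_covers X" by (simp add: open_covers_def)
  then show ?case using 0 by (intro bexI[of _ "{topspace X}"]) auto
next
  case (Suc k)
  let ?\<O> = "{V. openin X V \<and> \<not> forceable X P k (G \<union> V)}"
  have "?\<O> \<in> open_covers X"
    using Suc.prems by (intro open_coversI) auto
  then have "(\<forall>V\<in>?\<O>. openin X V) \<and> \<Union>?\<O> = topspace X" unfolding open_covers_def by (rule CollectD)
  then have "\<exists>\<V>. countable \<V> \<and> \<V> \<subseteq> ?\<O> \<and> \<Union>\<V> = topspace X"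
    by (rule L[unfolded Lindelof_space_def, THEN spec, THEN mp])
  then obtain \<V> where \<V>: "countable \<V>" "\<V> \<subseteq> ?\<O>" "\<Union>\<V> = topspace X" by (elim exE conjE)
  define D where "D = from_nat_into \<V>"
  have "\<V> \<noteq> {}" using \<V>(3) ne by (metis Union_empty)
  then have D: "range D = \<V>" unfolding D_def by (rule range_from_nat_into[OF _ \<V>(1)])
  then have D': "openin X (D i)" "\<not> forceable X P k (G \<union> D i)" for i using \<V>(2) by blast+
  have "\<forall>i. \<exists>\<U>. \<U> \<in> open_covers X \<and> (\<forall>\<A>\<subseteq>\<U>. finite \<A> \<and> card \<A> \<le> k \<longrightarrow> \<not> P (G \<union> D i \<union> \<Union>\<A>))"
    using Suc.IH[OF D'(2)] by blast
  then obtain \<U> where \<U>: "\<And>i. \<U> i \<in> open_covers X"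
    "\<And>i \<A>. \<lbrakk>\<A> \<subseteq> \<U> i; finite \<A>; card \<A> \<le> k\<rbrakk> \<Longrightarrow> \<not> P (G \<union> D i \<union> \<Union>\<A>)"
    by metis
  \<comment> \<open>Among \<open>k + 1\<close> members, one of least index \<open>i\<close> lies in \<open>D i\<close>, and the others refine \<open>\<U> i\<close>.\<close>
  define \<W> where "\<W> = {D i \<inter> V | i V. V \<in> cover_meet X {..i} \<U>}"
  have refine: "cover_meet X {..i} \<U> \<in> open_covers X" for i
    by (rule cover_meet_open_cover) (simp_all add: \<U>(1))
  have "\<W> \<in> open_covers X"
  proof (rule open_coversI)
    show "openin X W" if "W \<in> \<W>" for W
      using that D'(1) open_covers_openin[OF refine] unfolding \<W>_def by blast
    fix x assume x: "x \<in> topspace X"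
    then obtain i where "x \<in> D i" using D \<V>(3) by blast
    moreover obtain V where "V \<in> cover_meet X {..i} \<U>" "x \<in> V"
      using open_covers_ex[OF refine x] by blast
    ultimately show "\<exists>W\<in>\<W>. x \<in> W" unfolding \<W>_def by blast
  qed
  moreover have "\<not> P (G \<union> \<Union>\<A>)" if \<A>: "\<A> \<subseteq> \<W>" "finite \<A>" "card \<A> \<le> Suc k" for \<A>
  proof (cases "\<A> = {}")
    \<comment> \<open>An empty family has no least index; monotonicity brings the failure at
      \<open>G \<union> D 0\<close> down to \<open>G\<close>.\<close>
    case True
    have "\<not> P (G \<union> D 0 \<union> \<Union>{})" by (rule \<U>(2)) auto
    then show ?thesis using mono[of G "G \<union> D 0"] True by auto
  next
    case False
    have "\<forall>A\<in>\<A>. \<exists>i. A \<subseteq> D i \<and> (\<forall>j\<le>i. \<exists>U\<in>\<U> j. A \<subseteq> U)"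
    proof
      fix A assume "A \<in> \<A>"
      then obtain i V where "A = D i \<inter> V" "V \<in> cover_meet X {..i} \<U>"
        using \<A>(1) unfolding \<W>_def by blast
      then show "\<exists>i. A \<subseteq> D i \<and> (\<forall>j\<le>i. \<exists>U\<in>\<U> j. A \<subseteq> U)"
        using cover_meet_refines by (metis atMost_iff inf.coboundedI2 inf_le1)
    qed
    then obtain idx where idx: "\<And>A. A \<in> \<A> \<Longrightarrow> A \<subseteq> D (idx A)"
      "\<And>A j. \<lbrakk>A \<in> \<A>; j \<le> idx A\<rbrakk> \<Longrightarrow> \<exists>U\<in>\<U> j. A \<subseteq> U"
      by metis
    obtain A\<^sub>0 where A\<^sub>0: "A\<^sub>0 \<in> \<A>" "\<And>A. A \<in> \<A> \<Longrightarrow> idx A\<^sub>0 \<le> idx A"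
      using ex_min_if_finite[of "idx ` \<A>"] \<A>(2) False by (metis arg_min_least arg_min_if_finite(1))
    define i where "i = idx A\<^sub>0"
    have "\<forall>A\<in>\<A>. \<exists>U. U \<in> \<U> i \<and> A \<subseteq> U" using idx(2) A\<^sub>0(2) unfolding i_def by blast
    then obtain up where up: "\<And>A. A \<in> \<A> \<Longrightarrow> up A \<in> \<U> i \<and> A \<subseteq> up A" by metis
    have "card (up ` (\<A> - {A\<^sub>0})) \<le> k"
      using card_image_le[of "\<A> - {A\<^sub>0}" up] \<A>(2,3) A\<^sub>0(1) by simp
    then have "\<not> P (G \<union> D i \<union> \<Union>(up ` (\<A> - {A\<^sub>0})))"
      using up \<A>(2) by (intro \<U>(2)) auto
    moreover have "\<Union>\<A> \<subseteq> D i \<union> \<Union>(up ` (\<A> - {A\<^sub>0}))"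
    proof (rule Union_least)
      fix A assume "A \<in> \<A>"
      then show "A \<subseteq> D i \<union> \<Union>(up ` (\<A> - {A\<^sub>0}))"
        using idx(1)[OF A\<^sub>0(1), folded i_def] up[of A] by (cases "A = A\<^sub>0") auto
    qed
    then have "G \<union> \<Union>\<A> \<subseteq> G \<union> D i \<union> \<Union>(up ` (\<A> - {A\<^sub>0}))" by (simp add: le_supI1 Un_assoc le_supI2)
    ultimately show ?thesis using mono by metis
  qed
  ultimately show ?case by blast
qed

text \<open>Any two lists of the chain agree on common positions, so entry \<open>i\<close> can be
  read from any list long enough. Steps may append nothing, as the simulated position grows only at
  the end of a block.\<close>

lemma prefix_chain_limit:
  fixes S :: "nat \<Rightarrow> 'b list"
  assumes step: "\<And>m. \<exists>l. S (Suc m) = S m @ l"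
    and unb: "\<And>N. \<exists>m. N < length (S m)"
  shows "\<exists>p. \<forall>m. S m = map p [0..<length (S m)]"
proof -
  have chain: "\<exists>l. S m' = S m @ l" if "m \<le> m'" for m m'
    using that
  proof (induction rule: dec_induct)
    case (step m')
    then show ?case using assms(1)[of m'] by (metis append.assoc)
  qed simp
  obtain M where M: "\<And>N. N < length (S (M N))" using unb by metis
  have "S m ! i = S (M i) ! i" if "i < length (S m)" for m i
    using chain[of m "M i"] chain[of "M i" m] that M[of i]
    by (metis nat_le_linear nth_append)
  then show ?thesis
    by (intro exI[of _ "\<lambda>i. S (M i) ! i"] allI nth_equalityI) simp_all
qed

lemma winning_strategy_II_single:
  assumes n: "n > 0" and ws: "winning_strategy_II (Rothberger_game n X) \<tau>"
  shows "\<exists>\<tau>. winning_strategy_II (Rothberger_game 1 X) \<tau>"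
proof -
  let ?C = "open_covers X"
  have \<tau>: "length (\<tau> ps) = n \<and> set (\<tau> ps) \<subseteq> last ps" if "ps \<noteq> []" "set ps \<subseteq> ?C" for ps
    using winning_strategy_II_legal[OF ws that] .
  \<comment> \<open>On an empty space I could play the empty cover, which has no members for the
    \<open>n > 0\<close> answers due.\<close>
  have ne: "topspace X \<noteq> {}"
  proof
    assume "topspace X = {}"
    then have "{} \<in> ?C" by (simp add: open_covers_def)
    then show False using \<tau>[of "[{}]"] n by auto
  qed
  define P where "P ps H \<longleftrightarrow> (\<exists>\<U>\<in>?C. \<Union>(set (\<tau> (ps @ [\<U>]))) \<subseteq> H)" for ps H
  \<comment> \<open>Otherwise some cover has no family of at most \<open>n\<close> members whose
    union satisfies \<open>P ps\<close>, yet the answer of \<open>\<tau>\<close> to that very cover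
    is such a family.\<close>
  have start: "forceable X (P ps) n {}" if ps: "set ps \<subseteq> ?C" for ps
  proof (rule ccontr)
    assume nf: "\<not> ?thesis"
    have "\<exists>\<U>\<in>?C. \<forall>\<A>\<subseteq>\<U>. finite \<A> \<and> card \<A> \<le> n \<longrightarrow> \<not> P ps ({} \<union> \<Union>\<A>)"
      by (rule not_forceable_cover[OF Lindelof_space_if_winning_strategy_II[OF ws] ne _ nf])
        (auto simp: P_def)
    then obtain \<U> where \<U>: "\<U> \<in> ?C"
      "\<And>\<A>. \<lbrakk>\<A> \<subseteq> \<U>; finite \<A>; card \<A> \<le> n\<rbrakk> \<Longrightarrow> \<not> P ps (\<Union>\<A>)" by auto
    have "\<not> P ps (\<Union>(set (\<tau> (ps @ [\<U>]))))"
      using \<tau>[of "ps @ [\<U>]"] ps \<U>(1) card_length[of "\<tau> (ps @ [\<U>])"] by (intro \<U>(2)) auto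
    then show False using \<U>(1) unfolding P_def by blast
  qed
  \<comment> \<open>A state consists of the position in the simulated run of \<open>G\<^sub>n\<close>, the union of II's answers in the
    current block, and the number of answers left in the block.\<close>
  define inv where "inv st \<longleftrightarrow> (case st of (ps, G, k) \<Rightarrow>
      set ps \<subseteq> ?C \<and> 0 < k \<and> k \<le> n \<and> forceable X (P ps) k G)" for st
  \<comment> \<open>I's simulated cover is fixed only when a block is complete, once II's answers in
    it contain the reply of \<open>\<tau>\<close>.\<close>
  define R where "R st A st' \<longleftrightarrow> (case st of (ps, G, k) \<Rightarrow>
      (1 < k \<and> st' = (ps, G \<union> A, k - 1)) \<or>
      (k = 1 \<and> (\<exists>\<U>. st' = (ps @ [\<U>], {}, n) \<and> \<Union>(set (\<tau> (ps @ [\<U>]))) \<subseteq> G \<union> A)))" for st A st'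
  have "\<exists>A st'. A \<in> \<U> \<and> inv st' \<and> R st A st'" if st: "inv st" and \<U>: "\<U> \<in> ?C" for st \<U>
  proof -
    obtain ps G k where st_eq: "st = (ps, G, Suc k)" and ps: "set ps \<subseteq> ?C" and k: "Suc k \<le> n"
      and f: "forceable X (P ps) (Suc k) G"
      using st unfolding inv_def by (cases st) (auto simp: gr0_conv_Suc)
    obtain x where x: "x \<in> topspace X" "\<And>V. openin X V \<Longrightarrow> x \<in> V \<Longrightarrow> forceable X (P ps) k (G \<union> V)"
      using f by auto
    \<comment> \<open>The point \<open>x\<close> depends on the state alone, and any member of I's
      actual cover around it is an admissible neighbourhood.\<close>
    obtain A where A: "A \<in> \<U>" "x \<in> A" using open_covers_ex[OF \<U> x(1)] by blast
    have fA: "forceable X (P ps) k (G \<union> A)" using x(2) A open_covers_openin[OF \<U>] by blast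
    show ?thesis
    proof (cases "k = 0")
      case True
      then obtain \<V> where "\<V> \<in> ?C" "\<Union>(set (\<tau> (ps @ [\<V>]))) \<subseteq> G \<union> A"
        using fA unfolding P_def by auto
      then show ?thesis using A True n ps start
        by (intro exI[of _ A] exI[of _ "(ps @ [\<V>], {}, n)"]) (auto simp: inv_def R_def st_eq)
    next
      case False
      then show ?thesis using A k ps fA
        by (intro exI[of _ A] exI[of _ "(ps, G \<union> A, k)"]) (auto simp: inv_def R_def st_eq)
    qed
  qed
  then obtain pick nxt where step: "\<And>st \<U>. \<lbrakk>inv st; \<U> \<in> ?C\<rbrakk> \<Longrightarrow>
      pick st \<U> \<in> \<U> \<and> inv (nxt st \<U>) \<and> R st (pick st \<U>) (nxt st \<U>)"
    by metis
  define state where "state = foldl nxt ([], {}, n)"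
  have inv: "inv (state ps)" if "set ps \<subseteq> ?C" for ps
    using that
  proof (induction ps rule: rev_induct)
    case Nil
    then show ?case using n start[of "[]"] by (simp add: state_def inv_def)
  next
    case (snoc \<U> ps)
    then show ?case using step by (simp add: state_def)
  qed
  define \<tau>' where "\<tau>' ps = [pick (state (butlast ps)) (last ps)]" for ps
  have "winning_strategy_II (Rothberger_game 1 X) \<tau>'"
    unfolding winning_strategy_II_Rothberger_game
  proof (intro conjI allI impI)
    have "pick (state (butlast ps)) (last ps) \<in> last ps" if "ps \<noteq> []" "set ps \<subseteq> ?C" for ps
      using step[of "state (butlast ps)" "last ps"] inv[of "butlast ps"] that
      by (meson in_set_butlastD last_in_set subset_eq)
    then show "strategy_II (Rothberger_game 1 X) \<tau>'"
      by (simp add: strategy_II_Rothberger_game \<tau>'_def)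
    fix p :: "nat \<Rightarrow> 'a set set" assume "\<forall>m. p m \<in> ?C"
    then have p: "p m \<in> ?C" for m by blast
    define S where "S m = state (map p [0..<m])" for m
    define A where "A m = pick (S m) (p m)" for m
    have \<tau>'A: "\<tau>' (map p [0..<Suc m]) = [A m]" for m by (simp add: \<tau>'_def A_def S_def)
    have S0: "S 0 = ([], {}, n)" by (simp add: S_def state_def)
    have invS: "inv (S m)" for m unfolding S_def using p by (intro inv) auto
    have S_Suc: "S (Suc m) = nxt (S m) (p m)" for m by (simp add: S_def state_def)
    have A: "A m \<in> p m" and RS: "R (S m) (A m) (S (Suc m))" for m
      using step[OF invS[of m] p[of m]] by (simp_all add: A_def S_Suc)
    define hist where "hist m = fst (S m)" for m
    have hist_Suc: "\<exists>l. hist (Suc m) = hist m @ l" for m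
      using RS[of m] unfolding R_def hist_def by (auto split: prod.splits)
    \<comment> \<open>Each full block spends \<open>n\<close> rounds and adds one move to
      \<open>hist\<close>; the current block has spent \<open>n\<close> minus the counter.\<close>
    have count: "n * length (hist m) + n = m + snd (snd (S m))" for m
    proof (induction m)
      case (Suc m)
      then show ?case using RS[of m] unfolding R_def hist_def by (auto split: prod.splits)
    qed (simp add: S0 hist_def)
    have unbounded: "\<exists>m. N < length (hist m)" for N
    proof (rule ccontr)
      assume "\<not> ?thesis"
      then have "n * length (hist (n * N + n)) \<le> n * N" by (simp add: not_less)
      moreover have "0 < snd (snd (S (n * N + n)))"
        using invS[of "n * N + n"] unfolding inv_def by (auto split: prod.splits)
      ultimately show False using count[of "n * N + n"] by linarith
    qed
    obtain r where r: "\<And>m. hist m = map r [0..<length (hist m)]"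
      using prefix_chain_limit[of hist, OF hist_Suc unbounded] by blast
    have rC: "r i \<in> ?C" for i
    proof -
      obtain m where m: "i < length (hist m)" using unbounded by blast
      have "set (hist m) \<subseteq> ?C" using invS[of m] unfolding inv_def hist_def by (auto split: prod.splits)
      then show ?thesis using m r[of m] by (metis add_0 nth_map nth_upt nth_mem length_upt minus_nat.diff_0 subsetD)
    qed
    \<comment> \<open>The pending union is carried along because the reply that closes a block is
      bounded by it together with the last answer.\<close>
    have covered: "fst (snd (S m)) \<subseteq> (\<Union>j. A j) \<and>
        (\<forall>i<length (hist m). \<Union>(set (\<tau> (take (Suc i) (hist m)))) \<subseteq> (\<Union>j. A j))" for m
    proof (induction m)
      case (Suc m)
      then show ?case using RS[of m] unfolding R_def hist_def
        by (auto split: prod.splits simp: less_Suc_eq) blast+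
    qed (simp add: S0 hist_def)
    have "topspace X = (\<Union>i. \<Union>(set (\<tau> (map r [0..<Suc i]))))"
      by (rule winning_strategy_II_covers[OF ws rC])
    also have "\<dots> \<subseteq> (\<Union>j. A j)"
    proof (rule UN_least)
      fix i
      obtain m where m: "i < length (hist m)" using unbounded by blast
      then have "take (Suc i) (hist m) = map r [0..<Suc i]"
        by (subst r) (simp add: take_map del: upt_Suc)
      then show "\<Union>(set (\<tau> (map r [0..<Suc i]))) \<subseteq> (\<Union>j. A j)" using covered[of m] m by metis
    qed
    finally have "topspace X \<subseteq> (\<Union>j. A j)" .
    moreover have "A j \<subseteq> topspace X" for j
      using A p open_covers_openin openin_subset by metis
    ultimately have "topspace X = (\<Union>j. A j)" by (intro subset_antisym UN_least)
    then show "topspace X = (\<Union>m. \<Union>(set (\<tau>' (map p [0..<Suc m]))))" unfolding \<tau>'A by simp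
  qed
  then show ?thesis by blast
qed

theorem corollary2p4:
  fixes X :: "'a topology" and n :: nat
  assumes "Hausdorff_space X" and "n > 0"
  shows "equivalent_games (Rothberger_game 1 X) (Rothberger_game n X)"
  unfolding equivalent_games_def
  using winning_strategy_I_single winning_strategy_II_multi winning_strategy_II_single
    Rothberger_space_if_no_winning_strategy_I Rothberger_space_no_winning_strategy_I assms(2)
  by metis

end
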